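(* Let $\mathfrak{g}$ be a finite dimensional simple complex Lie algebra, $\sigma$ an automorphism of $\mathfrak{g}$ of finite order $m$, $\mathfrak{L}=\mathfrak{L}(\mathfrak{g},\sigma)$ the twisted loop algebra, and $t=z^m$. Let $\mathfrak{O}\subseteq\mathfrak{L}$ be a bounded coisotropic Lie subalgebra of $\mathfrak{L}$. Then $t\,\mathfrak{O}\subseteq\mathfrak{O}^\perp$, i.e. $\mathfrak{O}$ is stable under multiplication with the elements of $\mathbb{C}[t]$.
   Context: Let $\varepsilon=\exp(2\pi i/m)$ and $\mathfrak{g}_k=\{a\in\mathfrak{g}\,|\,\sigma(a)=\varepsilon^ka\}$ for $k\in\mathbb{Z}$. The twisted loop algebra is $\mathfrak{L}(\mathfrak{g},\sigma)=\bigoplus_{k\in\mathbb{Z}}\mathfrak{g}_kz^k\subset\mathfrak{g}[z,z^{-1}]$ with bracket $[az^k,bz^l]=[a,b]z^{k+l}$; it is a module over $R=\mathbb{C}[t,t^{-1}]$. Let $\kappa$ be the Killing form of $\mathfrak{g}$ and $B:\mathfrak{L}\times\mathfrak{L}\to\mathbb{C}$ the non-degenerate invariant symmetric bilinear form $B(az^k,bz^l)=\kappa(a,b)\delta_{k+l,0}$. Orthogonal complements $\perp$ are taken with respect to $B$; $\mathfrak{O}$ is coisotropic if $\mathfrak{O}^\perp\subseteq\mathfrak{O}$. Put $\mathfrak{L}_{\ge0}=\bigoplus_{k\ge0}\mathfrak{g}_kz^k$ and $\mathfrak{L}_{\ge n}=t^n\mathfrak{L}_{\ge0}$ for $n\in\mathbb{Z}$.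 A Lie subalgebra $\mathfrak{O}\subseteq\mathfrak{L}$ is bounded if $\mathfrak{L}_{\ge n}\subseteq\mathfrak{O}\subseteq\mathfrak{L}_{\ge-n}$ for some $n\in\mathbb{N}$. *)

theory Defs
  imports Complex_Main "HOL-Library.Poly_Mapping"
begin

section \<open>Lie algebras\<close>

locale lie_algebra = vector_space scale
  for scale :: "'k::field \<Rightarrow> 'g::ab_group_add \<Rightarrow> 'g" +
  fixes bracket :: "'g \<Rightarrow> 'g \<Rightarrow> 'g"
  assumes bracket_add_left: "bracket (x + y) z = bracket x z + bracket y z"
    and bracket_add_right: "bracket x (y + z) = bracket x y + bracket x z"
    and bracket_scale_left: "bracket (scale c x) y = scale c (bracket x y)"
    and bracket_scale_right: "bracket x (scale c y) = scale c (bracket x y)"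
    and bracket_self: "bracket x x = 0"
    and jacobi: "bracket x (bracket y z) + bracket y (bracket z x) + bracket z (bracket x y) = 0"
begin

definition lie_subalgebra :: "'g set \<Rightarrow> bool" where
  "lie_subalgebra S \<longleftrightarrow> subspace S \<and> (\<forall>x\<in>S. \<forall>y\<in>S. bracket x y \<in> S)"

definition lie_ideal :: "'g set \<Rightarrow> bool" where
  "lie_ideal I \<longleftrightarrow> subspace I \<and> (\<forall>x. \<forall>y\<in>I. bracket x y \<in> I)"

definition lie_automorphism :: "('g \<Rightarrow> 'g) \<Rightarrow> bool" where
  "lie_automorphism f \<longleftrightarrow>
     Vector_Spaces.linear scale scale f \<and> bij f \<and> (\<forall>x y. f (bracket x y) = bracket (f x) (f y))"

text \<open>
  The Laurent polynomials \<open>g[z, 1/z]\<close> with coefficients in the Lie algebra are the finitely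
  supported functions \<open>int \<Rightarrow>\<^sub>0 'g\<close>; the monomial \<open>a z^k\<close> is \<open>Poly_Mapping.single k a\<close>.
\<close>

definition loop_scale :: "'k \<Rightarrow> (int \<Rightarrow>\<^sub>0 'g) \<Rightarrow> (int \<Rightarrow>\<^sub>0 'g)" where
  "loop_scale c x = Poly_Mapping.map (scale c) x"

definition loop_bracket :: "(int \<Rightarrow>\<^sub>0 'g) \<Rightarrow> (int \<Rightarrow>\<^sub>0 'g) \<Rightarrow> (int \<Rightarrow>\<^sub>0 'g)" where
  "loop_bracket x y =
     (\<Sum>k\<in>Poly_Mapping.keys x. \<Sum>l\<in>Poly_Mapping.keys y.
        Poly_Mapping.single (k + l) (bracket (Poly_Mapping.lookup x k) (Poly_Mapping.lookup y l)))"

lemma bracket_zero_left [simp]: "bracket 0 x = 0"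
  using bracket_scale_left[of 0 0 x] by simp

lemma bracket_zero_right [simp]: "bracket x 0 = 0"
  using bracket_scale_right[of x 0 0] by simp

lemma bracket_antisym: "bracket x y + bracket y x = 0"
  using bracket_self[of "y + x"]
  unfolding bracket_add_left bracket_add_right by (simp add: bracket_self)

lemma lookup_loop_scale [simp]:
  "Poly_Mapping.lookup (loop_scale c x) k = scale c (Poly_Mapping.lookup x k)"
  by (simp add: loop_scale_def Poly_Mapping.map.rep_eq when_def)

lemma loop_bracket_superset:
  assumes "finite S" "Poly_Mapping.keys x \<subseteq> S" "finite T" "Poly_Mapping.keys y \<subseteq> T"
  shows "loop_bracket x y =
    (\<Sum>k\<in>S. \<Sum>l\<in>T.
       Poly_Mapping.single (k + l) (bracket (Poly_Mapping.lookup x k) (Poly_Mapping.lookup y l)))"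
proof -
  have "loop_bracket x y = (\<Sum>k\<in>Poly_Mapping.keys x. \<Sum>l\<in>T.
       Poly_Mapping.single (k + l) (bracket (Poly_Mapping.lookup x k) (Poly_Mapping.lookup y l)))"
    unfolding loop_bracket_def
    by (intro sum.cong refl sum.mono_neutral_left) (use assms in \<open>auto simp: in_keys_iff\<close>)
  also have "\<dots> = (\<Sum>k\<in>S. \<Sum>l\<in>T.
       Poly_Mapping.single (k + l) (bracket (Poly_Mapping.lookup x k) (Poly_Mapping.lookup y l)))"
    by (intro sum.mono_neutral_left) (use assms in \<open>auto simp: in_keys_iff\<close>)
  finally show ?thesis .
qed

lemma loop_bracket_single [simp]:
  "loop_bracket (Poly_Mapping.single k a) (Poly_Mapping.single l b)
     = Poly_Mapping.single (k + l) (bracket a b)"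
  by (subst loop_bracket_superset[of "{k}" _ "{l}"]) auto

lemma loop_bracket_add_left: "loop_bracket (x + y) z = loop_bracket x z + loop_bracket y z"
proof -
  let ?S = "Poly_Mapping.keys x \<union> Poly_Mapping.keys y"
  have "Poly_Mapping.keys (x + y) \<subseteq> ?S" by (rule Poly_Mapping.keys_add)
  then show ?thesis
    by (simp add: loop_bracket_superset[of ?S _ "Poly_Mapping.keys z"] lookup_add
        bracket_add_left single_add sum.distrib)
qed

lemma loop_bracket_add_right: "loop_bracket x (y + z) = loop_bracket x y + loop_bracket x z"
proof -
  let ?T = "Poly_Mapping.keys y \<union> Poly_Mapping.keys z"
  have "Poly_Mapping.keys (y + z) \<subseteq> ?T" by (rule Poly_Mapping.keys_add)
  then show ?thesis
    by (simp add: loop_bracket_superset[of "Poly_Mapping.keys x" _ ?T] lookup_add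
        bracket_add_right single_add sum.distrib)
qed

lemma loop_bracket_zero [simp]: "loop_bracket 0 x = 0" "loop_bracket x 0 = 0"
  by (simp_all add: loop_bracket_def)

lemma loop_bracket_sum_left: "loop_bracket (sum f A) y = (\<Sum>i\<in>A. loop_bracket (f i) y)"
  by (induction A rule: infinite_finite_induct) (simp_all add: loop_bracket_add_left)

lemma loop_bracket_sum_right: "loop_bracket x (sum f A) = (\<Sum>i\<in>A. loop_bracket x (f i))"
  by (induction A rule: infinite_finite_induct) (simp_all add: loop_bracket_add_right)

lemma loop_vector_space: "vector_space loop_scale"
  by unfold_locales
    (auto intro!: poly_mapping_eqI simp: lookup_add scale_right_distrib scale_left_distrib)

lemma loop_scale_single: "loop_scale c (Poly_Mapping.single k a) = Poly_Mapping.single k (scale c a)"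
  by (rule poly_mapping_eqI) (simp add: lookup_single when_def)

lemma loop_scale_sum: "loop_scale c (sum f A) = (\<Sum>i\<in>A. loop_scale c (f i))"
  by (rule poly_mapping_eqI) (simp add: lookup_sum scale_sum_right)

lemma loop_expand:
  assumes "finite S" "Poly_Mapping.keys x \<subseteq> S"
  shows "x = (\<Sum>k\<in>S. Poly_Mapping.single k (Poly_Mapping.lookup x k))"
  by (rule poly_mapping_eqI)
    (use assms in \<open>auto simp: lookup_sum lookup_single when_def in_keys_iff subset_iff\<close>)

lemma loop_bracket_antisym: "loop_bracket x y + loop_bracket y x = 0"
proof -
  let ?S = "Poly_Mapping.keys x" and ?T = "Poly_Mapping.keys y"
  have "loop_bracket y x = (\<Sum>k\<in>?S. \<Sum>l\<in>?T.
      Poly_Mapping.single (k + l) (bracket (Poly_Mapping.lookup y l) (Poly_Mapping.lookup x k)))"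
    unfolding loop_bracket_def by (subst sum.swap) (simp add: add.commute)
  then show ?thesis
    by (simp add: loop_bracket_def sum.distrib [symmetric] single_add [symmetric] bracket_antisym)
qed

lemma loop_bracket_self: "loop_bracket x x = 0"
proof -
  have *: "\<forall>x. Poly_Mapping.keys x \<subseteq> S \<longrightarrow> loop_bracket x x = 0" if "finite S" for S
    using that
  proof induction
    case empty
    then show ?case by (simp add: loop_bracket_def)
  next
    case (insert s S)
    show ?case
    proof (intro allI impI)
      fix x :: "int \<Rightarrow>\<^sub>0 'g" assume x: "Poly_Mapping.keys x \<subseteq> insert s S"
      define u where "u = Poly_Mapping.single s (Poly_Mapping.lookup x s)"
      define v where "v = (\<Sum>k\<in>S. Poly_Mapping.single k (Poly_Mapping.lookup x k))"
      have "x = u + v"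
        using loop_expand[OF _ x] insert.hyps by (simp add: u_def v_def)
      moreover have "Poly_Mapping.keys v \<subseteq> S"
        unfolding v_def
        by (auto simp: in_keys_iff lookup_sum lookup_single when_def insert.hyps split: if_splits)
      moreover have "loop_bracket u u = 0"
        by (simp add: u_def bracket_self)
      ultimately show "loop_bracket x x = 0"
        using insert.IH loop_bracket_antisym[of v u]
        by (simp add: loop_bracket_add_left loop_bracket_add_right)
    qed
  qed
  show ?thesis using *[of "Poly_Mapping.keys x"] by simp
qed

lemma loop_bracket_scale_left: "loop_bracket (loop_scale c x) y = loop_scale c (loop_bracket x y)"
proof -
  have "Poly_Mapping.keys (loop_scale c x) \<subseteq> Poly_Mapping.keys x"
    by (auto simp: in_keys_iff)
  then show ?thesis
    by (simp add: loop_bracket_superset[of "Poly_Mapping.keys x" _ "Poly_Mapping.keys y"]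
        bracket_scale_left loop_scale_sum loop_scale_single)
qed

lemma loop_bracket_scale_right: "loop_bracket x (loop_scale c y) = loop_scale c (loop_bracket x y)"
proof -
  have "Poly_Mapping.keys (loop_scale c y) \<subseteq> Poly_Mapping.keys y"
    by (auto simp: in_keys_iff)
  then show ?thesis
    by (simp add: loop_bracket_superset[of "Poly_Mapping.keys x" _ "Poly_Mapping.keys y"]
        bracket_scale_right loop_scale_sum loop_scale_single)
qed

lemma loop_jacobi:
  "loop_bracket x (loop_bracket y z) + loop_bracket y (loop_bracket z x)
     + loop_bracket z (loop_bracket x y) = 0"
proof -
  let ?X = "Poly_Mapping.keys x" and ?Y = "Poly_Mapping.keys y" and ?Z = "Poly_Mapping.keys z"
  let ?x = "Poly_Mapping.lookup x" and ?y = "Poly_Mapping.lookup y" and ?z = "Poly_Mapping.lookup z"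
  have triple: "loop_bracket u (loop_bracket v w) =
      (\<Sum>i\<in>Poly_Mapping.keys u. \<Sum>j\<in>Poly_Mapping.keys v. \<Sum>k\<in>Poly_Mapping.keys w.
        Poly_Mapping.single (i + (j + k)) (bracket (Poly_Mapping.lookup u i)
          (bracket (Poly_Mapping.lookup v j) (Poly_Mapping.lookup w k))))" for u v w
  proof -
    have "loop_bracket u (loop_bracket v w) =
        loop_bracket (\<Sum>i\<in>Poly_Mapping.keys u. Poly_Mapping.single i (Poly_Mapping.lookup u i))
          (loop_bracket v w)"
      using loop_expand[of "Poly_Mapping.keys u" u] by simp
    also have "\<dots> = (\<Sum>i\<in>Poly_Mapping.keys u.
        loop_bracket (Poly_Mapping.single i (Poly_Mapping.lookup u i)) (loop_bracket v w))"
      by (rule loop_bracket_sum_left)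
    finally show ?thesis
      by (simp add: loop_bracket_def[of v w] loop_bracket_sum_right)
  qed
  have yzx: "loop_bracket y (loop_bracket z x) = (\<Sum>i\<in>?X. \<Sum>j\<in>?Y. \<Sum>k\<in>?Z.
      Poly_Mapping.single (i + (j + k)) (bracket (?y j) (bracket (?z k) (?x i))))"
  proof -
    have "loop_bracket y (loop_bracket z x) = (\<Sum>j\<in>?Y. \<Sum>i\<in>?X. \<Sum>k\<in>?Z.
        Poly_Mapping.single (i + (j + k)) (bracket (?y j) (bracket (?z k) (?x i))))"
      unfolding triple by (rule sum.cong[OF refl], subst sum.swap) (simp add: add_ac)
    also have "\<dots> = (\<Sum>i\<in>?X. \<Sum>j\<in>?Y. \<Sum>k\<in>?Z.
        Poly_Mapping.single (i + (j + k)) (bracket (?y j) (bracket (?z k) (?x i))))"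
      by (rule sum.swap)
    finally show ?thesis .
  qed
  have zxy: "loop_bracket z (loop_bracket x y) = (\<Sum>i\<in>?X. \<Sum>j\<in>?Y. \<Sum>k\<in>?Z.
      Poly_Mapping.single (i + (j + k)) (bracket (?z k) (bracket (?x i) (?y j))))"
  proof -
    have "loop_bracket z (loop_bracket x y) = (\<Sum>i\<in>?X. \<Sum>k\<in>?Z. \<Sum>j\<in>?Y.
        Poly_Mapping.single (k + (i + j)) (bracket (?z k) (bracket (?x i) (?y j))))"
      unfolding triple by (rule sum.swap)
    also have "\<dots> = (\<Sum>i\<in>?X. \<Sum>j\<in>?Y. \<Sum>k\<in>?Z.
        Poly_Mapping.single (i + (j + k)) (bracket (?z k) (bracket (?x i) (?y j))))"
      by (rule sum.cong[OF refl], subst sum.swap) (simp add: add_ac)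
    finally show ?thesis .
  qed
  show ?thesis
    unfolding triple[of x y z] yzx zxy
    by (simp add: sum.distrib [symmetric] single_add [symmetric] jacobi)
qed

theorem loop_lie_algebra: "lie_algebra loop_scale loop_bracket"
proof -
  interpret V: vector_space loop_scale by (rule loop_vector_space)
  show ?thesis
    by unfold_locales
      (rule loop_bracket_add_left loop_bracket_add_right loop_bracket_scale_left
        loop_bracket_scale_right loop_bracket_self loop_jacobi)+
qed

end

locale simple_lie_algebra = lie_algebra scale bracket
  for scale :: "'k::field \<Rightarrow> 'g::ab_group_add \<Rightarrow> 'g" and bracket +
  assumes nonabelian: "\<exists>x y. bracket x y \<noteq> 0"
    and ideal_trivial: "lie_ideal I \<Longrightarrow> I = {0} \<or> I = UNIV"

locale finite_dimensional_lie_algebra =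
  lie_algebra scale bracket + finite_dimensional_vector_space scale Basis
  for scale :: "'k::field \<Rightarrow> 'g::ab_group_add \<Rightarrow> 'g" and bracket and Basis
begin

text \<open>The value on a linear map does not depend on the chosen \<open>Basis\<close>.\<close>

definition endo_trace :: "('g \<Rightarrow> 'g) \<Rightarrow> 'k" where
  "endo_trace f = (\<Sum>b\<in>Basis. representation Basis (f b) b)"

definition killing_form :: "'g \<Rightarrow> 'g \<Rightarrow> 'k" where
  "killing_form a b = endo_trace (bracket a \<circ> bracket b)"

end

definition has_order :: "('a \<Rightarrow> 'a) \<Rightarrow> nat \<Rightarrow> bool" where
  "has_order f m \<longleftrightarrow> 0 < m \<and> f ^^ m = id \<and> (\<forall>j. 0 < j \<and> j < m \<longrightarrow> f ^^ j \<noteq> id)"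


section \<open>Twisted loop algebras\<close>

locale twisted_loop_algebra =
  simple_lie_algebra scale bracket + finite_dimensional_lie_algebra scale bracket Basis
  for scale :: "complex \<Rightarrow> 'g::ab_group_add \<Rightarrow> 'g" and bracket and Basis +
  fixes \<sigma> :: "'g \<Rightarrow> 'g" and m :: nat
  assumes automorphism: "lie_automorphism \<sigma>"
    and order: "has_order \<sigma> m"
begin

sublocale loop: lie_algebra loop_scale loop_bracket
  by (rule loop_lie_algebra)

definition eps :: complex where
  "eps = exp (2 * of_real pi * \<i> / of_nat m)"

definition eigenspace :: "int \<Rightarrow> 'g set" where
  "eigenspace k = {a. \<sigma> a = scale (eps powi k) a}"

definition twisted_loop :: "(int \<Rightarrow>\<^sub>0 'g) set" where
  "twisted_loop = {x. \<forall>k. Poly_Mapping.lookup x k \<in> eigenspace k}"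

text \<open>
  The action of \<open>R = \<complex>[t, 1/t]\<close> on \<open>g[z, 1/z]\<close> with \<open>t = z^m\<close>: the monomial \<open>c t^i\<close>, which is
  \<open>Poly_Mapping.single i c\<close>, sends \<open>a z^k\<close> to \<open>c a z^(m i + k)\<close>.
\<close>

definition act :: "(int \<Rightarrow>\<^sub>0 complex) \<Rightarrow> (int \<Rightarrow>\<^sub>0 'g) \<Rightarrow> (int \<Rightarrow>\<^sub>0 'g)" where
  "act p x =
     (\<Sum>i\<in>Poly_Mapping.keys p. \<Sum>k\<in>Poly_Mapping.keys x.
        Poly_Mapping.single (int m * i + k)
          (scale (Poly_Mapping.lookup p i) (Poly_Mapping.lookup x k)))"

definition t_pow :: "int \<Rightarrow> (int \<Rightarrow>\<^sub>0 complex)" where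
  "t_pow n = Poly_Mapping.single n 1"

text \<open>The subring \<open>\<complex>[t]\<close> of \<open>R\<close>.\<close>

definition polys :: "(int \<Rightarrow>\<^sub>0 complex) set" where
  "polys = {p. Poly_Mapping.keys p \<subseteq> {0..}}"

definition nonneg_part :: "(int \<Rightarrow>\<^sub>0 'g) set" where
  "nonneg_part = {x \<in> twisted_loop. Poly_Mapping.keys x \<subseteq> {0..}}"

definition filtration :: "int \<Rightarrow> (int \<Rightarrow>\<^sub>0 'g) set" where
  "filtration n = act (t_pow n) ` nonneg_part"

definition form :: "(int \<Rightarrow>\<^sub>0 'g) \<Rightarrow> (int \<Rightarrow>\<^sub>0 'g) \<Rightarrow> complex" where
  "form x y =
     (\<Sum>k\<in>Poly_Mapping.keys x. \<Sum>l\<in>Poly_Mapping.keys y.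
        if k + l = 0 then killing_form (Poly_Mapping.lookup x k) (Poly_Mapping.lookup y l) else 0)"

definition orth :: "(int \<Rightarrow>\<^sub>0 'g) set \<Rightarrow> (int \<Rightarrow>\<^sub>0 'g) set" where
  "orth S = {x \<in> twisted_loop. \<forall>y\<in>S. form x y = 0}"

definition coisotropic :: "(int \<Rightarrow>\<^sub>0 'g) set \<Rightarrow> bool" where
  "coisotropic S \<longleftrightarrow> orth S \<subseteq> S"

definition bounded_in_loop :: "(int \<Rightarrow>\<^sub>0 'g) set \<Rightarrow> bool" where
  "bounded_in_loop S \<longleftrightarrow> (\<exists>n::nat. filtration (int n) \<subseteq> S \<and> S \<subseteq> filtration (- int n))"

lemma lookup_act_t_pow:
  "Poly_Mapping.lookup (act (t_pow n) x) k = Poly_Mapping.lookup x (k - int m * n)"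
proof -
  have "(\<Sum>l\<in>Poly_Mapping.keys x. if int m * n + l = k then Poly_Mapping.lookup x l else 0)
      = (\<Sum>l\<in>Poly_Mapping.keys x. if l = k - int m * n then Poly_Mapping.lookup x l else 0)"
    by (intro sum.cong refl) auto
  then show ?thesis
    by (simp add: act_def t_pow_def lookup_sum lookup_single when_def in_keys_iff)
qed

lemma subspace_eigenspace: "subspace (eigenspace k)"
proof -
  interpret s: Vector_Spaces.linear scale scale \<sigma>
    using automorphism by (simp add: lie_automorphism_def)
  show ?thesis
    by (auto simp: subspace_def eigenspace_def s.add s.scale s.zero scale_right_distrib
        scale_left_commute)
qed

lemma bracket_eigenspace:
  assumes "a \<in> eigenspace k" "b \<in> eigenspace l"
  shows "bracket a b \<in> eigenspace (k + l)"
proof -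
  have "\<sigma> (bracket a b) = bracket (\<sigma> a) (\<sigma> b)"
    using automorphism by (simp add: lie_automorphism_def)
  moreover have "eps powi (k + l) = eps powi k * eps powi l"
    by (rule power_int_add) (simp add: eps_def)
  ultimately show ?thesis
    using assms by (simp add: eigenspace_def bracket_scale_left bracket_scale_right mult.commute)
qed

lemma lie_subalgebra_twisted_loop: "loop.lie_subalgebra twisted_loop"
  unfolding loop.lie_subalgebra_def
proof (intro conjI ballI)
  show "loop.subspace twisted_loop"
    using subspace_0[OF subspace_eigenspace] subspace_add[OF subspace_eigenspace]
      subspace_scale[OF subspace_eigenspace]
    by (auto simp: loop.subspace_def twisted_loop_def lookup_add)
next
  fix x y assume "x \<in> twisted_loop" "y \<in> twisted_loop"
  then have "Poly_Mapping.lookup (Poly_Mapping.single (k + l)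
      (bracket (Poly_Mapping.lookup x k) (Poly_Mapping.lookup y l))) j \<in> eigenspace j" for k l j
    using subspace_0[OF subspace_eigenspace] bracket_eigenspace
    by (auto simp: lookup_single when_def twisted_loop_def)
  then show "loop_bracket x y \<in> twisted_loop"
    unfolding twisted_loop_def loop_bracket_def mem_Collect_eq lookup_sum
    by (intro allI subspace_sum subspace_eigenspace)
qed

end

end

theory Submission
  imports Defs "HOL-Computational_Algebra.Formal_Laurent_Series" "Jordan_Normal_Form.Determinant"
begin

text \<open>
  Boundedness alone gives \<open>t\<OO> \<subseteq> \<OO>\<^sup>\<bottom>\<close>. Let \<open>K = \<complex>((z))\<close> and embed \<open>g[z, 1/z]\<close> into the
  finite-dimensional space \<open>g \<otimes> K\<close>. For \<open>x, y \<in> \<OO>\<close> the operator \<open>ad x ad y\<close> preserves \<open>\<OO>\<close>, whose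
  elements have poles of bounded order and which contains a \<open>K\<close>-basis, because the eigenvectors of
  \<open>\<sigma>\<close> span \<open>g\<close>. Hence the trace of \<open>ad x ad y\<close> over \<open>K\<close>, which is
  \<open>\<Sum> \<kappa>(x\<^sub>k, y\<^sub>l) z\<^bsup>k+l\<^esup>\<close>, has no pole. Its coefficient at \<open>z\<^bsup>-m\<^esup>\<close> is
  \<open>B(tx, y)\<close>, which therefore vanishes. Coisotropy then gives \<open>t\<OO> \<subseteq> \<OO>\<^sup>\<bottom> \<subseteq> \<OO>\<close>.
\<close>

no_notation fps_nth (infixl "$" 75)

section \<open>Traces over Laurent series\<close>

text \<open>Stated on coefficients because \<open>fls_subdegree\<close> is 0 at the zero series:
  here the zero series satisfies every bound, and sums need no case distinction on
  cancellation.\<close>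

definition fls_order_ge :: "int \<Rightarrow> 'a::zero fls \<Rightarrow> bool" where
  "fls_order_ge k f \<longleftrightarrow> (\<forall>i<k. fls_nth f i = 0)"

lemma fls_order_ge_iff: "fls_order_ge k f \<longleftrightarrow> f = 0 \<or> k \<le> fls_subdegree f"
  unfolding fls_order_ge_def
  by (metis fls_eq0_below_subdegree fls_subdegree_geI fls_zero_nth order_less_le_trans)

lemma fls_order_ge_mult:
  fixes f g :: "'a::idom fls"
  shows "fls_order_ge k f \<Longrightarrow> fls_order_ge l g \<Longrightarrow> fls_order_ge (k + l) (f * g)"
  by (cases "f = 0 \<or> g = 0") (auto simp: fls_order_ge_iff)

lemma fls_order_ge_prod:
  fixes f :: "'b \<Rightarrow> 'a::idom fls"
  assumes "\<And>i. i \<in> I \<Longrightarrow> fls_order_ge (k i) (f i)"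
  shows "fls_order_ge (sum k I) (prod f I)"
  using assms
proof (induction I rule: infinite_finite_induct)
  case (insert i I)
  then show ?case by (simp add: fls_order_ge_mult)
qed (simp_all add: fls_order_ge_iff)

lemma fls_order_ge_sum:
  assumes "\<And>i. i \<in> I \<Longrightarrow> fls_order_ge k (f i)"
  shows "fls_order_ge k (sum f I)"
  using assms by (induction I rule: infinite_finite_induct) (auto simp: fls_order_ge_def)

text \<open>By the Leibniz formula: each summand is a product of \<open>n\<close> entries up to
  sign, and a sign is a constant series of order 0.\<close>

lemma fls_order_ge_det:
  fixes A :: "'a::idom fls mat"
  assumes A: "A \<in> carrier_mat n n"
    and entries: "\<And>i j. i < n \<Longrightarrow> j < n \<Longrightarrow> fls_order_ge k (A $$ (i, j))"
  shows "fls_order_ge (int n * k) (det A)"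
  unfolding det_def'[OF A]
proof (intro fls_order_ge_sum)
  fix p assume "p \<in> {p. p permutes {0..<n}}"
  then have "fls_order_ge (\<Sum>i = 0..<n. k) (\<Prod>i = 0..<n. A $$ (i, p i))"
    by (intro fls_order_ge_prod entries) auto
  moreover have "fls_order_ge 0 (signof p :: 'a fls)"
    by (auto simp: sign_def fls_order_ge_iff)
  ultimately show "fls_order_ge (int n * k) (signof p * (\<Prod>i = 0..<n. A $$ (i, p i)))"
    using fls_order_ge_mult[of 0 "signof p :: 'a fls" "int n * k"] by simp
qed

section \<open>Traces under change of basis\<close>

lemma trace_mult_commute:
  fixes A B :: "'a::comm_semiring_0 mat"
  assumes "A \<in> carrier_mat n n" "B \<in> carrier_mat n n"
  shows "(\<Sum>i<n. (A * B) $$ (i, i)) = (\<Sum>i<n. (B * A) $$ (i, i))"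
proof -
  have "(\<Sum>i<n. (A * B) $$ (i, i)) = (\<Sum>i<n. \<Sum>j<n. A $$ (i, j) * B $$ (j, i))"
    using assms by (intro sum.cong) (auto simp: scalar_prod_def atLeast0LessThan)
  also have "\<dots> = (\<Sum>j<n. \<Sum>i<n. A $$ (i, j) * B $$ (j, i))"
    by (rule sum.swap)
  also have "\<dots> = (\<Sum>i<n. (B * A) $$ (i, i))"
    using assms by (intro sum.cong) (auto simp: scalar_prod_def atLeast0LessThan mult.commute)
  finally show ?thesis .
qed

lemma replace_col_mat_of_cols:
  "replace_col (mat_of_cols n vs) b k = mat_of_cols n (vs[k := b])"
  by (rule eq_matI) (auto simp: replace_col_def mat_of_cols_def nth_list_update)

text \<open>Conjugation by \<open>P\<close> does not change the trace. Column \<open>i\<close> of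
  the conjugate holds the coordinates of \<open>A *\<^sub>v col P i\<close> with respect to the
  columns of \<open>P\<close>, and Cramer's rule gives its diagonal entry.\<close>

lemma trace_eq_sum_replace_col:
  fixes A P :: "'a::field mat"
  assumes A: "A \<in> carrier_mat n n" and P: "P \<in> carrier_mat n n" and "det P \<noteq> 0"
  shows "(\<Sum>i<n. A $$ (i, i)) = (\<Sum>i<n. det (replace_col P (A *\<^sub>v col P i) i) / det P)"
proof -
  \<comment> \<open>\<open>undefined\<close> fills the extension field of the ring record.\<close>
  obtain Q where Q: "Q \<in> carrier_mat n n" "P * Q = 1\<^sub>m n" "Q * P = 1\<^sub>m n"
    using det_non_zero_imp_unit[OF P \<open>det P \<noteq> 0\<close>, of undefined]
    by (auto simp: Units_def ring_mat_def)
  define C where "C = Q * (A * P)"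
  have C: "C \<in> carrier_mat n n"
    using A P Q by (simp add: C_def)
  have PC: "P * C = A * P"
    using A P Q by (simp add: C_def flip: assoc_mult_mat[of P n n Q n "A * P" n])
  have "C $$ (i, i) * det P = det (replace_col P (A *\<^sub>v col P i) i)" if "i < n" for i
  proof -
    have "P *\<^sub>v col C i = A *\<^sub>v col P i"
      using PC that A P C by (metis carrier_matD(2) col_mult2)
    then show ?thesis
      using cramer_lemma_mat[OF P, of "col C i" i] that C by simp
  qed
  then have "(\<Sum>i<n. det (replace_col P (A *\<^sub>v col P i) i) / det P) = (\<Sum>i<n. C $$ (i, i))"
    using \<open>det P \<noteq> 0\<close> by (intro sum.cong) (auto simp flip: nonzero_eq_divide_eq)
  also have "\<dots> = (\<Sum>i<n. (A * P * Q) $$ (i, i))"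
    unfolding C_def using A P Q(1) by (intro trace_mult_commute) auto
  also have "A * P * Q = A"
    using A P Q by (simp add: assoc_mult_mat[of A n n P n Q n])
  finally show ?thesis by simp
qed

text \<open>
  Among the bases of \<open>K^n\<close> inside \<open>S\<close> one has a determinant of least order. Replacing one of
  its vectors \<open>v\<close> by \<open>A v \<in> S\<close> cannot lower that order, so by Cramer's rule the diagonal entries of
  \<open>A\<close> in this basis are power series. This avoids any structure theory of lattices.
\<close>

lemma fls_order_ge_trace:
  fixes A :: "'a::field fls mat"
  assumes A: "A \<in> carrier_mat n n" and S: "S \<subseteq> carrier_vec n"
    and stable: "\<And>v. v \<in> S \<Longrightarrow> A *\<^sub>v v \<in> S"
    and bounded: "\<And>v i. v \<in> S \<Longrightarrow> i < n \<Longrightarrow> fls_order_ge k (v $ i)"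
    and spanning: "\<exists>vs. set vs \<subseteq> S \<and> length vs = n \<and> det (mat_of_cols n vs) \<noteq> 0"
  shows "fls_order_ge 0 (\<Sum>i<n. A $$ (i, i))"
proof -
  define frame where
    "frame vs \<longleftrightarrow>
    set vs \<subseteq> S \<and> length vs = n \<and> det (mat_of_cols n vs) \<noteq> 0"
    for vs :: "'a fls vec list"
  define ord where "ord vs = fls_subdegree (det (mat_of_cols n vs))" for vs :: "'a fls vec list"
  have ord_ge: "int n * k \<le> ord vs" if "frame vs" for vs
  proof -
    have "fls_order_ge (int n * k) (det (mat_of_cols n vs))"
      using that bounded
      by (intro fls_order_ge_det) (auto simp: frame_def mat_of_cols_index subset_iff)
    then show ?thesis
      using that by (simp add: fls_order_ge_iff frame_def ord_def)
  qed
  \<comment> \<open>The values of \<open>ord\<close> are integers; subtracting the lower bound from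
    \<open>ord_ge\<close> makes the truncation by \<open>nat\<close> harmless, so a minimum
    exists.\<close>
  obtain vs where vs: "frame vs"
    and min: "\<And>ws. frame ws \<Longrightarrow> nat (ord vs - int n * k) \<le> nat (ord ws - int n * k)"
    using ex_has_least_nat[of frame _ "\<lambda>vs. nat (ord vs - int n * k)"] spanning
    unfolding frame_def by metis
  let ?P = "mat_of_cols n vs"
  have P: "?P \<in> carrier_mat n n" and det: "det ?P \<noteq> 0"
    using vs by (auto simp: frame_def)
  have "fls_order_ge 0 (det (replace_col ?P (A *\<^sub>v col ?P i) i) / det ?P)" if "i < n" for i
  proof (cases "det (replace_col ?P (A *\<^sub>v col ?P i) i) = 0")
    \<comment> \<open>The exchanged family is then no frame and minimality says nothing about it,
      but the quotient itself is 0.\<close>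
    case True
    then show ?thesis by (simp add: fls_order_ge_iff)
  next
    case False
    have "vs ! i \<in> S"
      using vs that by (auto simp: frame_def)
    moreover have "set (vs[i := A *\<^sub>v vs ! i]) \<subseteq> insert (A *\<^sub>v vs ! i) (set vs)"
      by (rule set_update_subset_insert)
    moreover have "col ?P i = vs ! i"
      using vs that S \<open>vs ! i \<in> S\<close> by (intro col_mat_of_cols) (auto simp: frame_def)
    ultimately have "frame (vs[i := A *\<^sub>v vs ! i])"
      using vs False stable unfolding frame_def replace_col_mat_of_cols by auto
    then have "ord vs \<le> ord (vs[i := A *\<^sub>v vs ! i])"
      using min[of "vs[i := A *\<^sub>v vs ! i]"] ord_ge[of "vs[i := A *\<^sub>v vs ! i]"] by linarith
    then show ?thesis
      using False det \<open>col ?P i = vs ! i\<close>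
      by (simp add: replace_col_mat_of_cols ord_def fls_order_ge_iff fls_divide_subdegree)
  qed
  then show ?thesis
    unfolding trace_eq_sum_replace_col[OF A P det] by (intro fls_order_ge_sum) auto
qed


section \<open>The adjoint representation over Laurent series\<close>

context finite_dimensional_lie_algebra
begin

text \<open>An arbitrary enumeration of \<open>Basis\<close>, since matrices are indexed by natural
  numbers.\<close>

definition basis_list :: "'g list" where
  "basis_list = (SOME bs. set bs = Basis \<and> distinct bs)"

lemma set_basis_list: "set basis_list = Basis"
  and distinct_basis_list: "distinct basis_list"
  using someI_ex[OF finite_distinct_list[OF finite_Basis]] by (auto simp: basis_list_def)

lemma length_basis_list: "length basis_list = dimension"
  using distinct_card[OF distinct_basis_list] by (simp add: set_basis_list dimension_def)

lemma sum_basis_list: "(\<Sum>i<dimension. f (basis_list ! i)) = sum f Basis"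
  using sum.reindex_bij_betw[OF bij_betw_nth[OF distinct_basis_list refl set_basis_list[symmetric]], of f]
  by (simp add: length_basis_list)

definition coord :: "'g \<Rightarrow> nat \<Rightarrow> 'k" where
  "coord v i = representation Basis v (basis_list ! i)"

lemma coord_zero [simp]: "coord 0 i = 0"
  by (simp add: coord_def representation_zero)

lemma coord_add: "coord (u + v) i = coord u i + coord v i"
  by (simp add: coord_def representation_add independent_Basis span_Basis)

lemma coord_scale: "coord (scale c v) i = c * coord v i"
  by (simp add: coord_def representation_scale independent_Basis span_Basis)

lemma coord_sum: "coord (sum f I) i = (\<Sum>j\<in>I. coord (f j) i)"
  by (simp add: coord_def representation_sum independent_Basis span_Basis)

lemma coord_basis_list:
  assumes "i < dimension" "j < dimension"
  shows "coord (basis_list ! j) i = (if i = j then 1 else 0)"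
  using assms set_basis_list nth_mem[of j basis_list] nth_eq_iff_index_eq[OF distinct_basis_list, of i j]
  by (auto simp: coord_def representation_basis independent_Basis length_basis_list)

lemma sum_coord: "(\<Sum>i<dimension. scale (coord v i) (basis_list ! i)) = v"
  unfolding coord_def sum_basis_list[of "\<lambda>b. scale (representation Basis v b) b"]
  by (rule sum_representation_eq) (simp_all add: independent_Basis span_Basis finite_Basis)

lemma bracket_sum_right: "bracket x (sum f I) = (\<Sum>i\<in>I. bracket x (f i))"
  by (induction I rule: infinite_finite_induct) (simp_all add: bracket_add_right)

lemma coord_bracket:
  "coord (bracket u v) i = (\<Sum>j<dimension. coord (bracket u (basis_list ! j)) i * coord v j)"
proof -
  have "coord (bracket u v) i
      = coord (bracket u (\<Sum>j<dimension. scale (coord v j) (basis_list ! j))) i"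
    by (simp only: sum_coord)
  then show ?thesis
    by (simp add: bracket_sum_right bracket_scale_right coord_sum coord_scale mult.commute)
qed

lemma killing_form_zero_left [simp]: "killing_form 0 v = 0"
  by (simp add: killing_form_def endo_trace_def representation_zero)

lemma killing_form_coord:
  "killing_form u v = (\<Sum>i<dimension. coord (bracket u (bracket v (basis_list ! i))) i)"
  unfolding coord_def sum_basis_list[of "\<lambda>b. representation Basis (bracket u (bracket v b)) b"]
  by (simp add: killing_form_def endo_trace_def)

section \<open>Coefficients of loops and of their brackets\<close>

lemma sum_single_lookup:
  "(\<Sum>k\<in>Poly_Mapping.keys w. Poly_Mapping.single k (Poly_Mapping.lookup w k)) = w"
  by (rule loop_expand[symmetric]) auto

lemma lookup_loop_bracket:
  "Poly_Mapping.lookup (loop_bracket x y) n =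
    (\<Sum>l\<in>Poly_Mapping.keys y.
      bracket (Poly_Mapping.lookup x (n - l)) (Poly_Mapping.lookup y l))"
proof -
  have "Poly_Mapping.lookup (loop_bracket x y) n =
      (\<Sum>l\<in>Poly_Mapping.keys y. \<Sum>k\<in>Poly_Mapping.keys x.
        if k = n - l then bracket (Poly_Mapping.lookup x k) (Poly_Mapping.lookup y l) else 0)"
    unfolding loop_bracket_def lookup_sum lookup_single
    by (subst sum.swap, intro sum.cong refl) (auto simp: when_def)
  also have "\<dots> = (\<Sum>l\<in>Poly_Mapping.keys y.
      bracket (Poly_Mapping.lookup x (n - l)) (Poly_Mapping.lookup y l))"
    by (intro sum.cong refl) (auto simp: in_keys_iff)
  finally show ?thesis .
qed

lemma lookup_loop_bracket_single:
  "Poly_Mapping.lookup (loop_bracket x (Poly_Mapping.single k a)) n =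
    bracket (Poly_Mapping.lookup x (n - k)) a"
  by (simp add: lookup_loop_bracket)

text \<open>The image of \<open>w\<close> after extension of scalars to Laurent series, read in the
  coordinates of \<open>basis_list\<close>. Finite support of \<open>w\<close> makes
  \<open>Abs_fls\<close> produce the intended series.\<close>

definition loop_vec :: "(int \<Rightarrow>\<^sub>0 'g) \<Rightarrow> 'k fls vec" where
  "loop_vec w = vec dimension (\<lambda>i. Abs_fls (\<lambda>k. coord (Poly_Mapping.lookup w k) i))"

lemma dim_loop_vec [simp]: "dim_vec (loop_vec w) = dimension"
  by (simp add: loop_vec_def)

lemma loop_vec_carrier: "loop_vec w \<in> carrier_vec dimension"
  by (rule carrier_vecI) simp

lemma fls_nth_loop_vec:
  assumes "i < dimension"
  shows "fls_nth (loop_vec w $ i) k = coord (Poly_Mapping.lookup w k) i"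
proof -
  \<comment> \<open>The inserted 0 covers \<open>w = 0\<close>, where there are no keys.\<close>
  have "\<forall>n < Min (insert 0 (Poly_Mapping.keys w)). coord (Poly_Mapping.lookup w n) i = 0"
    by (auto simp: in_keys_iff)
  then have "\<exists>N. \<forall>n<N. coord (Poly_Mapping.lookup w n) i = 0" by (rule exI)
  then show ?thesis
    using assms by (simp add: loop_vec_def nth_Abs_fls_ex_lower_bound)
qed

lemma loop_vec_add: "loop_vec (u + v) = loop_vec u + loop_vec v"
  by (rule eq_vecI) (auto intro!: fls_eqI simp: fls_nth_loop_vec lookup_add coord_add)

lemma loop_vec_zero: "loop_vec 0 = 0\<^sub>v dimension"
  by (rule eq_vecI) (auto intro!: fls_eqI simp: fls_nth_loop_vec)

lemma loop_vec_single:
  assumes "i < dimension"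
  shows "loop_vec (Poly_Mapping.single k a) $ i = fls_shift (- k) (fls_const (coord a i))"
  using assms by (intro fls_eqI) (simp add: fls_nth_loop_vec lookup_single when_def)

text \<open>The extension of \<open>loop_bracket x\<close> that is linear over Laurent series is
  determined by the constant loops on the basis; their images are the columns.\<close>

definition ad_mat :: "(int \<Rightarrow>\<^sub>0 'g) \<Rightarrow> 'k fls mat" where
  "ad_mat x = mat_of_cols dimension
     (map (\<lambda>b. loop_vec (loop_bracket x (Poly_Mapping.single 0 b))) basis_list)"

lemma ad_mat_carrier: "ad_mat x \<in> carrier_mat dimension dimension"
  using mat_of_cols_carrier(1)[of dimension "map _ basis_list"]
  by (simp add: ad_mat_def length_basis_list)

lemma col_ad_mat:
  "i < dimension \<Longrightarrow>
    col (ad_mat x) i = loop_vec (loop_bracket x (Poly_Mapping.single 0 (basis_list ! i)))"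
  unfolding ad_mat_def by (subst col_mat_of_cols) (auto simp: length_basis_list loop_vec_carrier)

lemma index_ad_mat:
  "i < dimension \<Longrightarrow> j < dimension \<Longrightarrow>
    ad_mat x $$ (i, j) = loop_vec (loop_bracket x (Poly_Mapping.single 0 (basis_list ! j))) $ i"
  unfolding ad_mat_def by (subst mat_of_cols_index) (auto simp: length_basis_list)

text \<open>The power \<open>z^k\<close> is a scalar for the matrix, and bracketing with
  \<open>x\<close> commutes with it. What remains is the expansion of \<open>a\<close> in the basis,
  given by \<open>coord_bracket\<close>.\<close>

lemma ad_mat_mult_single:
  "ad_mat x *\<^sub>v loop_vec (Poly_Mapping.single k a)
    = loop_vec (loop_bracket x (Poly_Mapping.single k a))"
proof (rule eq_vecI)
  fix i assume "i < dim_vec (loop_vec (loop_bracket x (Poly_Mapping.single k a)))"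
  then have i: "i < dimension" by simp
  have "(ad_mat x *\<^sub>v loop_vec (Poly_Mapping.single k a)) $ i =
      (\<Sum>j<dimension. ad_mat x $$ (i, j) * loop_vec (Poly_Mapping.single k a) $ j)"
    using i ad_mat_carrier[of x] by (auto simp: scalar_prod_def atLeast0LessThan intro!: sum.cong)
  also have "\<dots> = loop_vec (loop_bracket x (Poly_Mapping.single k a)) $ i"
    using i
    by (intro fls_eqI)
      (simp add: fls_nth_sum index_ad_mat loop_vec_single fls_shifted_times_simps fls_nth_loop_vec
        lookup_loop_bracket_single coord_bracket[of _ a])
  finally show "(ad_mat x *\<^sub>v loop_vec (Poly_Mapping.single k a)) $ i =
      loop_vec (loop_bracket x (Poly_Mapping.single k a)) $ i" .
qed (use ad_mat_carrier[of x] in auto)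

lemma ad_mat_mult: "ad_mat x *\<^sub>v loop_vec w = loop_vec (loop_bracket x w)"
proof -
  have step: "ad_mat x *\<^sub>v loop_vec (\<Sum>k\<in>S. Poly_Mapping.single k (f k))
      = loop_vec (loop_bracket x (\<Sum>k\<in>S. Poly_Mapping.single k (f k)))" if "finite S" for S f
    using that
  proof induction
    case empty
    then show ?case
      using ad_mat_carrier[of x] by (auto simp: loop_vec_zero)
  next
    case (insert k S)
    then show ?case
      using mult_add_distrib_mat_vec[OF ad_mat_carrier loop_vec_carrier loop_vec_carrier]
      by (simp add: loop_vec_add ad_mat_mult_single loop_bracket_add_right)
  qed
  then show ?thesis
    using step[of "Poly_Mapping.keys w" "Poly_Mapping.lookup w"] by (simp add: sum_single_lookup)
qed

text \<open>Diagonal entry \<open>i\<close> is coordinate \<open>i\<close> of the double bracket of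
  \<open>x\<close> and \<open>y\<close> with the basis vector \<open>i\<close>; its part of degree
  \<open>n\<close> pairs the degrees \<open>n - l\<close> and \<open>l\<close>. Summing over
  \<open>i\<close> turns each pair into a Killing form. For \<open>n = 0\<close> this is
  \<open>form x y\<close>.\<close>

lemma fls_nth_trace_ad_mat:
  "fls_nth (\<Sum>i<dimension. (ad_mat x * ad_mat y) $$ (i, i)) n =
    (\<Sum>l\<in>Poly_Mapping.keys y.
      killing_form (Poly_Mapping.lookup x (n - l)) (Poly_Mapping.lookup y l))"
proof -
  have nested: "Poly_Mapping.lookup (loop_bracket x (loop_bracket y (Poly_Mapping.single 0 b))) n =
      (\<Sum>l\<in>Poly_Mapping.keys y.
        bracket (Poly_Mapping.lookup x (n - l)) (bracket (Poly_Mapping.lookup y l) b))" for b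
  proof -
    have "loop_bracket y (Poly_Mapping.single 0 b) =
        loop_bracket (\<Sum>l\<in>Poly_Mapping.keys y. Poly_Mapping.single l (Poly_Mapping.lookup y l))
          (Poly_Mapping.single 0 b)"
      by (simp only: sum_single_lookup)
    then show ?thesis
      by (simp add: loop_bracket_sum_left loop_bracket_sum_right lookup_sum
          lookup_loop_bracket_single)
  qed
  have "fls_nth ((ad_mat x * ad_mat y) $$ (i, i)) n =
      coord (Poly_Mapping.lookup (loop_bracket x (loop_bracket y
        (Poly_Mapping.single 0 (basis_list ! i)))) n) i" if "i < dimension" for i
  proof -
    have "(ad_mat x * ad_mat y) $$ (i, i) = (ad_mat x *\<^sub>v col (ad_mat y) i) $ i"
      using that ad_mat_carrier[of x] ad_mat_carrier[of y] by auto
    then show ?thesis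
      using that by (simp add: col_ad_mat ad_mat_mult fls_nth_loop_vec)
  qed
  then have "fls_nth (\<Sum>i<dimension. (ad_mat x * ad_mat y) $$ (i, i)) n =
      (\<Sum>i<dimension. \<Sum>l\<in>Poly_Mapping.keys y. coord (bracket (Poly_Mapping.lookup x (n - l))
        (bracket (Poly_Mapping.lookup y l) (basis_list ! i))) i)"
    by (simp add: fls_nth_sum nested coord_sum)
  also have "\<dots> = (\<Sum>l\<in>Poly_Mapping.keys y.
      killing_form (Poly_Mapping.lookup x (n - l)) (Poly_Mapping.lookup y l))"
    unfolding killing_form_coord by (rule sum.swap)
  finally show ?thesis .
qed

text \<open>Column \<open>j\<close> is a basis vector of the Lie algebra times
  \<open>z^(k j)\<close>, with arbitrary exponents. A right inverse is the change of basis matrix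
  with row \<open>j\<close> multiplied by the inverse power of \<open>z\<close>.\<close>

lemma det_loop_vec_nonzero:
  assumes "distinct cs" "independent (set cs)" "span (set cs) = UNIV" "length cs = dimension"
  shows "det (mat_of_cols dimension
    (map (\<lambda>j. loop_vec (Poly_Mapping.single (k j) (cs ! j))) [0..<dimension])) \<noteq> 0"
proof -
  let ?P = "mat_of_cols dimension
    (map (\<lambda>j. loop_vec (Poly_Mapping.single (k j) (cs ! j))) [0..<dimension])"
  let ?Q = "mat dimension dimension (\<lambda>(j, l).
    fls_shift (k j) (fls_const (representation (set cs) (basis_list ! l) (cs ! j))))"
  have P: "?P \<in> carrier_mat dimension dimension"
    using mat_of_cols_carrier(1)[of dimension "map _ [0..<dimension]"] by simp
  have expand: "(\<Sum>j<dimension. scale (representation (set cs) v (cs ! j)) (cs ! j)) = v" for v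
  proof -
    have "(\<Sum>j<dimension. scale (representation (set cs) v (cs ! j)) (cs ! j))
        = (\<Sum>c\<in>set cs. scale (representation (set cs) v c) c)"
      using assms by (intro sum.reindex_bij_betw bij_betw_nth) auto
    also have "\<dots> = v"
      using assms by (intro sum_representation_eq) auto
    finally show ?thesis .
  qed
  have "?P * ?Q = 1\<^sub>m dimension"
  proof (rule eq_matI)
    fix i l assume "i < dim_row (1\<^sub>m dimension :: 'k fls mat)" "l < dim_col (1\<^sub>m dimension :: 'k fls mat)"
    then have il: "i < dimension" "l < dimension" by auto
    have "(?P * ?Q) $$ (i, l) = (\<Sum>j<dimension. ?P $$ (i, j) * ?Q $$ (j, l))"
      using il by (simp add: scalar_prod_def atLeast0LessThan)
    also have "\<dots> = (\<Sum>j<dimension. fls_const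
        (coord (scale (representation (set cs) (basis_list ! l) (cs ! j)) (cs ! j)) i))"
      using il
      by (intro sum.cong refl)
        (simp add: mat_of_cols_index loop_vec_single fls_times_both_shifted_simp coord_scale mult.commute)
    also have "\<dots> = fls_const (coord (basis_list ! l) i)"
      using arg_cong[OF expand[of "basis_list ! l"], of "\<lambda>v. coord v i"]
      by (intro fls_eqI) (simp add: coord_sum fls_nth_sum)
    finally show "(?P * ?Q) $$ (i, l) = 1\<^sub>m dimension $$ (i, l)"
      using il by (simp add: coord_basis_list)
  qed (use P in auto)
  then have "det ?P * det ?Q = 1"
    using det_mult[OF P, of ?Q] by simp
  then show ?thesis by auto
qed

end


section \<open>Twisted loop algebras\<close>

context twisted_loop_algebra
begin

section \<open>Roots of unity and the eigenspaces of \<sigma>\<close>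

lemma order_pos: "0 < m"
  using order by (simp add: has_order_def)

lemma funpow_order: "\<sigma> ^^ m = id"
  using order by (simp add: has_order_def)

lemma eps_nonzero: "eps \<noteq> 0"
  by (simp add: eps_def)

lemma eps_power: "eps ^ j = cis (2 * pi * real j / real m)"
proof -
  have "eps = cis (2 * pi / real m)"
    by (simp add: eps_def cis_conv_exp mult_ac)
  then show ?thesis
    by (simp add: DeMoivre mult_ac)
qed

lemma eps_power_order: "eps ^ m = 1"
  using order_pos by (simp add: eps_power)

text \<open>Primitivity of \<open>eps\<close>, read off from the injectivity of the standard
  enumeration of the \<open>m\<close>-th roots of unity.\<close>

lemma eps_power_eq_1:
  assumes "j < m" "eps ^ j = 1"
  shows "j = 0"
proof -
  have "cis (2 * pi * real j / real m) = cis (2 * pi * real 0 / real m)"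
    using assms(2) by (simp add: eps_power)
  then show ?thesis
    using bij_betw_roots_unity[OF order_pos] assms(1) order_pos
    by (auto simp: bij_betw_def inj_on_def)
qed

text \<open>Follows from \<open>eps ^ m = 1\<close>. It is the reason why multiplication by powers
  of \<open>t = z^m\<close> preserves \<open>twisted_loop\<close>.\<close>

lemma eigenspace_periodic: "eigenspace (k + int m * l) = eigenspace k"
proof -
  have "eps powi (k + int m * l) = eps powi k * (eps powi int m) powi l"
    by (simp add: power_int_add eps_nonzero power_int_mult)
  then show ?thesis
    by (simp add: eigenspace_def eps_power_order)
qed

lemma linear_automorphism: "Vector_Spaces.linear scale scale \<sigma>"
  using automorphism by (simp add: lie_automorphism_def)

text \<open>Discrete Fourier inversion: averaging the orbit of \<open>a\<close> under \<sigma>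
  against the powers of \<open>inverse eps\<close> projects to the eigenspaces, and the projections
  add up to \<open>a\<close>.\<close>

lemma span_eigenspaces: "span (\<Union>k. eigenspace k) = UNIV"
proof -
  interpret s: Vector_Spaces.linear scale scale \<sigma>
    by (rule linear_automorphism)
  have "a \<in> span (\<Union>k. eigenspace k)" for a
  proof -
    let ?u = "inverse eps"
    define h where "h k j = scale (?u ^ (j * k)) ((\<sigma> ^^ j) a)" for k j :: nat
    have h_Suc: "\<sigma> (h k j) = scale (eps ^ k) (h k (Suc j))" for k j
      by (simp add: h_def s.scale power_add eps_nonzero field_simps power_inverse)
    \<comment> \<open>The terms at 0 and \<open>m\<close> agree, as \<sigma> and \<open>eps\<close>
      both become trivial at the power \<open>m\<close>; the shift permutes the sum
      cyclically.\<close>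
    have "(\<Sum>j<m. h k (Suc j)) = (\<Sum>j<m. h k j)" for k
    proof -
      have "h k m = h k 0"
        using eps_power_order
        by (simp add: h_def funpow_order power_mult power_inverse)
      then show ?thesis
        using sum.lessThan_Suc_shift[of "h k" m] by simp
    qed
    then have "\<sigma> (\<Sum>j<m. h k j) = scale (eps ^ k) (\<Sum>j<m. h k j)" for k
      by (simp add: s.sum h_Suc flip: scale_sum_right)
    then have "(\<Sum>j<m. h k j) \<in> eigenspace (int k)" for k
      by (simp add: eigenspace_def)
    then have "(\<Sum>j<m. h k j) \<in> span (\<Union>k. eigenspace k)" for k
      by (intro span_base UN_I[OF UNIV_I])
    then have "scale (1 / of_nat m) (\<Sum>k<m. \<Sum>j<m. h k j) \<in> span (\<Union>k. eigenspace k)"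
      by (rule span_scale[OF span_sum])
    moreover have "(\<Sum>k<m. \<Sum>j<m. h k j) = scale (of_nat m) a"
    proof -
      \<comment> \<open>Orthogonality of characters: for \<open>j\<close> nonzero the ratio of the
        geometric sum is an \<open>m\<close>-th root of unity other than 1.\<close>
      have sum_u: "(\<Sum>k<m. ?u ^ (j * k)) = (if j = 0 then of_nat m else 0)" if "j < m" for j
      proof (cases "j = 0")
        case False
        have "(?u ^ j) ^ m = (?u ^ m) ^ j"
          by (metis power_mult mult.commute)
        then have "(?u ^ j) ^ m = 1"
          by (simp add: power_inverse eps_power_order)
        moreover have "?u ^ j \<noteq> 1"
          using eps_power_eq_1[OF that] False by (auto simp: power_inverse)
        ultimately show ?thesis
          using False by (simp add: power_mult geometric_sum)
      qed simp
      have "(\<Sum>k<m. \<Sum>j<m. h k j) = (\<Sum>j<m. \<Sum>k<m. h k j)"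
        by (rule sum.swap)
      also have "\<dots> = (\<Sum>j<m. scale (if j = 0 then of_nat m else 0) ((\<sigma> ^^ j) a))"
        by (intro sum.cong refl) (simp add: h_def sum_u flip: scale_sum_left)
      also have "\<dots> = (\<Sum>j<m. if j = 0 then scale (of_nat m) a else 0)"
        by (intro sum.cong) auto
      also have "\<dots> = scale (of_nat m) a"
        using order_pos by simp
      finally show ?thesis .
    qed
    ultimately show ?thesis
      using order_pos by simp
  qed
  then show ?thesis by blast
qed

section \<open>The filtration and its frames of eigenvectors\<close>

lemma lookup_filtration:
  "w \<in> filtration n \<Longrightarrow> k < int m * n \<Longrightarrow> Poly_Mapping.lookup w k = 0"
  by (force simp: filtration_def nonneg_part_def lookup_act_t_pow in_keys_iff subset_iff)

lemma single_in_filtration: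
  assumes "a \<in> eigenspace k" "int m * n \<le> k"
  shows "Poly_Mapping.single k a \<in> filtration n"
proof -
  have "a \<in> eigenspace (k - int m * n)"
    using assms(1) eigenspace_periodic[of "k - int m * n" n] by simp
  then have "Poly_Mapping.single (k - int m * n) a \<in> nonneg_part"
    using assms(2) subspace_0[OF subspace_eigenspace]
    by (auto simp: nonneg_part_def twisted_loop_def lookup_single when_def split: if_splits)
  moreover have "Poly_Mapping.single k a = act (t_pow n) (Poly_Mapping.single (k - int m * n) a)"
    by (rule poly_mapping_eqI) (simp add: lookup_act_t_pow lookup_single when_def)
  ultimately show ?thesis
    unfolding filtration_def by blast
qed

lemma form_eq:
  "form x y = (\<Sum>l\<in>Poly_Mapping.keys y.
    killing_form (Poly_Mapping.lookup x (- l)) (Poly_Mapping.lookup y l))"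
proof -
  have "form x y = (\<Sum>l\<in>Poly_Mapping.keys y. \<Sum>k\<in>Poly_Mapping.keys x.
      if k = - l then killing_form (Poly_Mapping.lookup x k) (Poly_Mapping.lookup y l) else 0)"
    unfolding form_def by (subst sum.swap, intro sum.cong refl) auto
  also have "\<dots> = (\<Sum>l\<in>Poly_Mapping.keys y.
      killing_form (Poly_Mapping.lookup x (- l)) (Poly_Mapping.lookup y l))"
    by (intro sum.cong refl) (auto simp: in_keys_iff)
  finally show ?thesis .
qed

text \<open>The eigenvectors span, so some of them form a basis. Each can be placed in any degree of
  its residue class modulo \<open>m\<close>, hence in one large enough for
  \<open>filtration n\<close>; the degrees may vary with the vector.\<close>

lemma filtration_frame:
  "\<exists>vs. set vs \<subseteq> loop_vec ` filtration n \<and> length vs = dimension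
    \<and> det (mat_of_cols dimension vs) \<noteq> 0"
proof -
  obtain C where C: "C \<subseteq> (\<Union>k. eigenspace k)" "independent C" "(\<Union>k. eigenspace k) \<subseteq> span C"
    using maximal_independent_subset by blast
  have span: "span C = UNIV"
    using span_minimal[OF C(3) subspace_span] span_eigenspaces by blast
  obtain cs where cs: "set cs = C" "distinct cs"
    using finite_distinct_list[OF finiteI_independent[OF C(2)]] by blast
  have length: "length cs = dimension"
    using distinct_card[OF cs(2)] cs(1) dim_eq_card[of C UNIV] C(2) span dim_UNIV by (simp add: dimension_def)
  have "\<exists>k. c \<in> eigenspace k \<and> int m * n \<le> k" if "c \<in> C" for c
  proof -
    obtain k where "c \<in> eigenspace k"
      using C(1) \<open>c \<in> C\<close> by blast
    \<comment> \<open>Since \<open>m\<close> is at least 1, adding this multiple of \<open>m\<close>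
      to \<open>k\<close> reaches \<open>int m * n\<close>.\<close>
    moreover have "\<bar>int m * n - k\<bar> \<le> int m * \<bar>int m * n - k\<bar>"
      using order_pos mult_right_mono[of 1 "int m" "\<bar>int m * n - k\<bar>"] by simp
    ultimately show ?thesis
      by (intro exI[of _ "k + int m * \<bar>int m * n - k\<bar>"]) (simp add: eigenspace_periodic)
  qed
  then obtain k where k: "\<And>c. c \<in> C \<Longrightarrow> c \<in> eigenspace (k c) \<and> int m * n \<le> k c"
    by metis
  have "det (mat_of_cols dimension
      (map (\<lambda>j. loop_vec (Poly_Mapping.single (k (cs ! j)) (cs ! j))) [0..<dimension])) \<noteq> 0"
    using cs C(2) span length by (intro det_loop_vec_nonzero) auto
  moreover have "Poly_Mapping.single (k (cs ! j)) (cs ! j) \<in> filtration n" if "j < dimension" for j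
    using that k[of "cs ! j"] cs(1) length by (intro single_in_filtration) auto
  ultimately show ?thesis
    by (intro exI conjI) auto
qed

text \<open>Applies \<open>fls_order_ge_trace\<close> to the image of \<open>S\<close>: closure
  under brackets gives stability, the outer filtration bound limits the poles, and the inner one
  supplies a frame. The image is used as a mere set and need not be a subspace over Laurent
  series.\<close>

lemma form_act_t_eq_0:
  assumes sub: "loop.lie_subalgebra S" and bounded: "bounded_in_loop S"
    and x: "x \<in> S" and y: "y \<in> S"
  shows "form (act (t_pow 1) x) y = 0"
proof -
  obtain n :: nat where n: "filtration (int n) \<subseteq> S" "S \<subseteq> filtration (- int n)"
    using bounded by (auto simp: bounded_in_loop_def)
  have closed: "loop_bracket a b \<in> S" if "a \<in> S" "b \<in> S" for a b
    using sub that by (simp add: loop.lie_subalgebra_def)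
  have "fls_order_ge 0 (\<Sum>i<dimension. (ad_mat x * ad_mat y) $$ (i, i))"
  proof (rule fls_order_ge_trace)
    show "ad_mat x * ad_mat y \<in> carrier_mat dimension dimension"
      by (rule mult_carrier_mat[OF ad_mat_carrier ad_mat_carrier])
    show "loop_vec ` S \<subseteq> carrier_vec dimension"
      using loop_vec_carrier by blast
    show "(ad_mat x * ad_mat y) *\<^sub>v v \<in> loop_vec ` S" if "v \<in> loop_vec ` S" for v
      using that closed x y assoc_mult_mat_vec[OF ad_mat_carrier ad_mat_carrier loop_vec_carrier]
      by (auto simp: ad_mat_mult)
    show "fls_order_ge (int m * (- int n)) (v $ i)" if "v \<in> loop_vec ` S" "i < dimension" for v i
    proof -
      from that(1) obtain w where "w \<in> S" "v = loop_vec w" by blast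
      then show ?thesis
        using lookup_filtration[of w "- int n"] n(2) that(2)
        by (auto simp: fls_order_ge_def fls_nth_loop_vec)
    qed
    show "\<exists>vs. set vs \<subseteq> loop_vec ` S \<and> length vs = dimension
        \<and> det (mat_of_cols dimension vs) \<noteq> 0"
      using filtration_frame[of "int n"] n(1) by (meson image_mono order_trans)
  qed
  \<comment> \<open>Multiplication by \<open>t\<close> raises degrees by \<open>m\<close>, so the
    form pairs degrees of \<open>x\<close> and \<open>y\<close> with sum \<open>- int m\<close>,
    which is negative.\<close>
  then have "fls_nth (\<Sum>i<dimension. (ad_mat x * ad_mat y) $$ (i, i)) (- int m) = 0"
    using order_pos by (simp add: fls_order_ge_def)
  then show ?thesis
    by (simp add: form_eq fls_nth_trace_ad_mat lookup_act_t_pow minus_diff_commute)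
qed

section \<open>Stability under polynomials in t\<close>

lemma act_t_pow_in_twisted_loop: "x \<in> twisted_loop \<Longrightarrow> act (t_pow n) x \<in> twisted_loop"
  using eigenspace_periodic[of "k - int m * n" n for k]
  by (auto simp: twisted_loop_def lookup_act_t_pow)

text \<open>Reduces the action of a Laurent polynomial to that of powers of \<open>t\<close>, where
  coefficients are merely shifted.\<close>

lemma act_expand:
  "act p x = (\<Sum>i\<in>Poly_Mapping.keys p. loop_scale (Poly_Mapping.lookup p i) (act (t_pow i) x))"
proof (rule poly_mapping_eqI)
  fix n
  have "(\<Sum>k\<in>Poly_Mapping.keys x. if int m * i + k = n then scale c (Poly_Mapping.lookup x k) else 0)
      = scale c (Poly_Mapping.lookup x (n - int m * i))" for i c
  proof -
    have "(\<Sum>k\<in>Poly_Mapping.keys x. if int m * i + k = n then scale c (Poly_Mapping.lookup x k) else 0)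
      = (\<Sum>k\<in>Poly_Mapping.keys x. if k = n - int m * i then scale c (Poly_Mapping.lookup x k) else 0)"
      by (intro sum.cong) auto
    then show ?thesis by (simp add: in_keys_iff)
  qed
  then show "Poly_Mapping.lookup (act p x) n = Poly_Mapping.lookup
      (\<Sum>i\<in>Poly_Mapping.keys p. loop_scale (Poly_Mapping.lookup p i) (act (t_pow i) x)) n"
    unfolding act_def[of p] by (simp add: lookup_sum lookup_single when_def lookup_act_t_pow)
qed

lemma act_t_pow_0: "act (t_pow 0) x = x"
  by (rule poly_mapping_eqI) (simp add: lookup_act_t_pow)

lemma act_t_pow_add: "act (t_pow (i + j)) x = act (t_pow i) (act (t_pow j) x)"
  by (rule poly_mapping_eqI) (simp add: lookup_act_t_pow algebra_simps)

text \<open>Induction yields all nonnegative powers of \<open>t\<close>, the only ones occurring in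
  \<open>p\<close>; linear combinations stay in the subspace.\<close>

lemma act_polys_closed:
  assumes S: "loop.subspace S" and t: "\<And>x. x \<in> S \<Longrightarrow> act (t_pow 1) x \<in> S"
    and "p \<in> polys" "x \<in> S"
  shows "act p x \<in> S"
proof -
  have "act (t_pow (int j)) x \<in> S" for j
  proof (induction j)
    case (Suc j)
    then show ?case
      using t act_t_pow_add[of 1 "int j" x] by simp
  qed (simp add: act_t_pow_0 \<open>x \<in> S\<close>)
  then have "act (t_pow i) x \<in> S" if "i \<in> Poly_Mapping.keys p" for i
    using that \<open>p \<in> polys\<close> by (metis atLeast_iff in_mono mem_Collect_eq polys_def zero_le_imp_eq_int)
  then show ?thesis
    by (subst act_expand) (intro loop.subspace_sum[OF S] loop.subspace_scale[OF S])
qed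

lemma act_t_image_subset_orth:
  assumes "loop.lie_subalgebra S" "S \<subseteq> twisted_loop" "bounded_in_loop S"
  shows "act (t_pow 1) ` S \<subseteq> orth S"
  using assms act_t_pow_in_twisted_loop form_act_t_eq_0 by (auto simp: orth_def)

end

theorem theorem3p11:
  fixes scale :: "complex \<Rightarrow> 'g::ab_group_add \<Rightarrow> 'g"
    and bracket :: "'g \<Rightarrow> 'g \<Rightarrow> 'g"
    and Basis :: "'g set"
    and \<sigma> :: "'g \<Rightarrow> 'g"
    and m :: nat
    and \<OO> :: "(int \<Rightarrow>\<^sub>0 'g) set"
  assumes "simple_lie_algebra scale bracket"
    and "finite_dimensional_vector_space scale Basis"
    and "lie_algebra.lie_automorphism scale bracket \<sigma>"
    and "has_order \<sigma> m"
    and "lie_algebra.lie_subalgebra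
           (lie_algebra.loop_scale scale) (lie_algebra.loop_bracket bracket) \<OO>"
    and "\<OO> \<subseteq> twisted_loop_algebra.twisted_loop scale \<sigma> m"
    and "twisted_loop_algebra.bounded_in_loop scale \<sigma> m \<OO>"
    and "twisted_loop_algebra.coisotropic scale bracket Basis \<sigma> m \<OO>"
  shows "twisted_loop_algebra.act scale m (twisted_loop_algebra.t_pow 1) ` \<OO>
           \<subseteq> twisted_loop_algebra.orth scale bracket Basis \<sigma> m \<OO>
       \<and> (\<forall>p \<in> twisted_loop_algebra.polys.
            twisted_loop_algebra.act scale m p ` \<OO> \<subseteq> \<OO>)"
proof -
  interpret simple_lie_algebra scale bracket by fact
  interpret finite_dimensional_vector_space scale Basis by fact
  interpret twisted_loop_algebra scale bracket Basis \<sigma> m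
    by unfold_locales fact+
  have orth: "act (t_pow 1) ` \<OO> \<subseteq> orth \<OO>"
    by (rule act_t_image_subset_orth) fact+
  \<comment> \<open>Coisotropy leads from the orthogonal complement back into
    \<open>\<OO>\<close>.\<close>
  then have "act (t_pow 1) x \<in> \<OO>" if "x \<in> \<OO>" for x
    using assms(8) that unfolding coisotropic_def by blast
  moreover have "loop.subspace \<OO>"
    using assms(5) by (simp add: loop.lie_subalgebra_def)
  ultimately have "\<forall>p\<in>polys. act p ` \<OO> \<subseteq> \<OO>"
    using act_polys_closed by blast
  with orth show ?thesis by blast
qed

end
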